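(* Let $n\in\mathbb{N}$, $n>1$, and let $h_1,h_2\in\mathcal{I}$. Suppose there is a permutation $\nu$ of the set $h_1(D_n)$, restricting to a permutation of the set $h_1(P^*_n)$, such that $h_2(x)=\nu(h_1(x))$ for all $x\in D_n$. Then $$\mathbb{Z}/\!\sim_{\preceq_{d^{(n)}_{(h_1,+)}}}\;=\;\mathbb{Z}/\!\sim_{\preceq_{d^{(n)}_{(h_2,+)}}}.$$
   Context: $\mathbb{N}$ is the set of positive integers, $D_n=\{x\in\mathbb{N}: x\mid n\}$, and $P^*_n$ is the set of prime powers $p^i$ ($p$ prime, $i\ge1$) dividing $n$. A function $h:\mathbb{N}\to\mathbb{R}$ is multiplicative if $h$ is not identically zero and $h(xy)=h(x)h(y)$ for all coprime $x,y\in\mathbb{N}$. $\mathcal{I}$ is the set of multiplicative $h$ with $0\le h(x)\le1$ for all $x>1$. For $h\in\mathcal{I}$ and $x,y\in\mathbb{Z}$, $d^{(n)}_{(h,+)}(x,y)=0$ if $x=y$ and $d^{(n)}_{(h,+)}(x,y)=2-h(\gcd(x,n))-h(\gcd(y,n))$ if $x\neq y$; this is a pseudometric on $\mathbb{Z}$. For a pseudometric $d$ on $\mathbb{Z}$, $x\preceq_d y\iff d(1,x)\le d(1,y)$, and $x\sim_{\preceq_d}y\iff(x\preceq_d y\text{ and }y\preceq_d x)$. $\mathbb{Z}/\!\sim$ denotes the set of equivalence classes. *)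

theory Defs
  imports "HOL-Number_Theory.Number_Theory"
begin

(* The paper's natural numbers are the positive integers.  Arithmetic functions are rendered
   on type nat; their value at 0 is unconstrained, and irrelevant as long as n > 0. *)

definition multiplicative :: "(nat \<Rightarrow> real) \<Rightarrow> bool" where
  "multiplicative h \<longleftrightarrow>
     (\<exists>x>0. h x \<noteq> 0) \<and> (\<forall>x>0. \<forall>y>0. coprime x y \<longrightarrow> h (x * y) = h x * h y)"

definition \<I> :: "(nat \<Rightarrow> real) set" where
  "\<I> = {h. multiplicative h \<and> (\<forall>x>1. 0 \<le> h x \<and> h x \<le> 1)}"

definition divisor_set :: "nat \<Rightarrow> nat set" where
  "divisor_set n = {x. x > 0 \<and> x dvd n}"

definition dist_plus :: "(nat \<Rightarrow> real) \<Rightarrow> nat \<Rightarrow> int \<Rightarrow> int \<Rightarrow> real" where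
  "dist_plus h n x y =
     (if x = y then 0 else 2 - h (nat (gcd x (int n))) - h (nat (gcd y (int n))))"

definition preceq :: "(int \<Rightarrow> int \<Rightarrow> real) \<Rightarrow> int \<Rightarrow> int \<Rightarrow> bool" where
  "preceq d x y \<longleftrightarrow> d 1 x \<le> d 1 y"

definition sim_rel :: "(int \<Rightarrow> int \<Rightarrow> real) \<Rightarrow> (int \<times> int) set" where
  "sim_rel d = {(x, y). preceq d x y \<and> preceq d y x}"

end

theory Submission
  imports Defs
begin

(* As h 1 = 1, the distance from 1 to x is 1 - h (gcd x n), also at x = 1.  So two integers are
   equivalent iff h agrees on their gcds with n, and since \<nu> is injective on the values of h1 on
   divisors of n, this holds for h1 iff it holds for h2 = \<nu> o h1. *)

text \<open>Multiplicativity at the coprime pair \<open>x\<close>, \<open>1\<close> allows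
  cancelling \<open>h x\<close> at a point where it is nonzero.\<close>

lemma multiplicative_1:
  assumes "multiplicative h"
  shows "h 1 = 1"
proof -
  obtain x where "x > 0" "h x \<noteq> 0"
    using assms by (auto simp: multiplicative_def)
  moreover have "h (x * 1) = h x * h 1"
    using assms \<open>x > 0\<close> unfolding multiplicative_def by (metis coprime_1_right zero_less_one)
  ultimately show ?thesis by simp
qed

text \<open>For \<open>x = 1\<close> the gcd is 1, so the right-hand side is
  \<open>1 - h 1 = 0\<close>, in agreement with the diagonal case of
  \<open>dist_plus\<close>.\<close>

lemma dist_plus_1_left:
  assumes "multiplicative h"
  shows "dist_plus h n 1 x = 1 - h (nat (gcd x (int n)))"
  using multiplicative_1[OF assms] by (simp add: dist_plus_def)

lemma mem_sim_rel_dist_plus_iff: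
  assumes "multiplicative h"
  shows "(x, y) \<in> sim_rel (dist_plus h n) \<longleftrightarrow>
    h (nat (gcd x (int n))) = h (nat (gcd y (int n)))"
  by (auto simp: sim_rel_def preceq_def dist_plus_1_left[OF assms])

text \<open>Brings the gcds into the range where \<open>h2\<close> is given by \<open>\<nu>\<close>
  and \<open>h1\<close>. Positivity of \<open>n\<close> rules out
  \<open>gcd 0 0 = 0\<close>.\<close>

lemma nat_gcd_in_divisor_set:
  assumes "n > 0"
  shows "nat (gcd x (int n)) \<in> divisor_set n"
  using assms by (simp add: divisor_set_def nat_dvd_iff)

theorem proposition4p7:
  fixes n :: nat and h1 h2 :: "nat \<Rightarrow> real" and \<nu> :: "real \<Rightarrow> real"
  assumes "n > 1"
    and "h1 \<in> \<I>" and "h2 \<in> \<I>"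
    and "bij_betw \<nu> (h1 ` divisor_set n) (h1 ` divisor_set n)"
    and "bij_betw \<nu> (h1 ` primepow_factors n) (h1 ` primepow_factors n)"
    and "\<And>x. x \<in> divisor_set n \<Longrightarrow> h2 x = \<nu> (h1 x)"
  shows "(UNIV :: int set) // sim_rel (dist_plus h1 n) = UNIV // sim_rel (dist_plus h2 n)"
proof -
  have mult: "multiplicative h1" "multiplicative h2"
    using assms(2,3) by (auto simp: \<I>_def)
  have inj: "inj_on \<nu> (h1 ` divisor_set n)"
    using assms(4) by (rule bij_betw_imp_inj_on)
  have "(x, y) \<in> sim_rel (dist_plus h1 n) \<longleftrightarrow> (x, y) \<in> sim_rel (dist_plus h2 n)" for x y
  proof -
    have "nat (gcd x (int n)) \<in> divisor_set n" "nat (gcd y (int n)) \<in> divisor_set n"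
      using assms(1) by (simp_all add: nat_gcd_in_divisor_set)
    then show ?thesis
      \<comment> \<open>With \<open>a\<close>, \<open>b\<close> the two gcds, what remains is
        \<open>h1 a = h1 b\<close> iff \<open>\<nu> (h1 a) = \<nu> (h1 b)\<close>.\<close>
      using inj by (simp add: mem_sim_rel_dist_plus_iff mult assms(6) inj_on_eq_iff)
  qed
  then have "sim_rel (dist_plus h1 n) = sim_rel (dist_plus h2 n)" by auto
  then show ?thesis by simp
qed

end
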